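(* Let $\mathrm{a}_{n,k}^{\mathrm{asc}}(213,312)$ (respectively $\mathrm{a}_{n,k}^{\mathrm{des}}(213,312)$) denote the number of permutations of $\{1,\dots,n\}$ that avoid both $213$ and $312$ and have exactly $k$ ascents (respectively $k$ descents). Then for all integers $n\ge 1$ and $k\ge 0$, $$\mathrm{a}_{n,k}^{\mathrm{asc}}(213,312)=\mathrm{a}_{n,k}^{\mathrm{des}}(213,312)=\binom{n-1}{k}.$$
   Context: $\mathcal{S}_n$ is the set of permutations $\pi=\pi_1\cdots\pi_n$ of $\{1,\dots,n\}$. For $\rho\in\mathcal{S}_m$, $\pi\in\mathcal{S}_n$ contains $\rho$ if there are indices $1\le i_1<\cdots<i_m\le n$ such that $\pi_{i_a}<\pi_{i_b}$ if and only if $\rho_a<\rho_b$; otherwise $\pi$ avoids $\rho$. The number of ascents is $\mathrm{asc}(\pi)=|\{i:\pi_i<\pi_{i+1}\}|$ and the number of descents is $\mathrm{des}(\pi)=|\{i:\pi_i>\pi_{i+1}\}|$, where $1\le i\le n-1$. *)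

theory Defs
  imports Main "HOL-Combinatorics.Multiset_Permutations"
begin

text \<open>
  A permutation \<open>\<pi>\<^sub>1 \<dots> \<pi>\<^sub>n\<close> of \<open>{1..n}\<close> is given in one-line notation, as a list in
  \<^term>\<open>permutations_of_set {1..n::nat}\<close>. List positions start at 0, so the entry
  \<open>\<pi>\<^sub>i\<close> is \<open>\<pi> ! (i - 1)\<close>.
\<close>

definition contains_pattern :: "nat list \<Rightarrow> nat list \<Rightarrow> bool" where
  "contains_pattern \<pi> \<rho> \<longleftrightarrow>
     (\<exists>i :: nat \<Rightarrow> nat.
        strict_mono_on {..<length \<rho>} i \<and>
        (\<forall>a<length \<rho>. i a < length \<pi>) \<and>
        (\<forall>a<length \<rho>. \<forall>b<length \<rho>. \<pi> ! i a < \<pi> ! i b \<longleftrightarrow> \<rho> ! a < \<rho> ! b))"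

definition avoids_pattern :: "nat list \<Rightarrow> nat list \<Rightarrow> bool" where
  "avoids_pattern \<pi> \<rho> \<longleftrightarrow> \<not> contains_pattern \<pi> \<rho>"

definition asc :: "nat list \<Rightarrow> nat" where
  "asc \<pi> = card {i. Suc i < length \<pi> \<and> \<pi> ! i < \<pi> ! Suc i}"

definition des :: "nat list \<Rightarrow> nat" where
  "des \<pi> = card {i. Suc i < length \<pi> \<and> \<pi> ! i > \<pi> ! Suc i}"

definition a_asc :: "nat \<Rightarrow> nat \<Rightarrow> nat list set \<Rightarrow> nat" where
  "a_asc n k P = card {\<pi> \<in> permutations_of_set {1..n}.
     (\<forall>\<rho>\<in>P. avoids_pattern \<pi> \<rho>) \<and> asc \<pi> = k}"

definition a_des :: "nat \<Rightarrow> nat \<Rightarrow> nat list set \<Rightarrow> nat" where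
  "a_des n k P = card {\<pi> \<in> permutations_of_set {1..n}.
     (\<forall>\<rho>\<in>P. avoids_pattern \<pi> \<rho>) \<and> des \<pi> = k}"

end

theory Submission
  imports Defs
begin

text \<open>
  Avoiding both 213 and 312 means that no entry lies below one entry on its left and one entry on
  its right. Applied to the maximum \<open>n\<close>, this says that \<open>\<pi>\<close> increases up to \<open>n\<close> and decreases
  afterwards. Such a \<open>\<pi>\<close> is determined by the set \<open>A \<subseteq> {1..n-1}\<close> of entries to the left of \<open>n\<close>,
  which is arbitrary, and \<open>\<pi>\<close> has \<open>|A|\<close> ascents and \<open>n - 1 - |A|\<close> descents.
\<close>

section \<open>Valleys and the two patterns\<close>

text \<open>Both 213 and 312 have their smallest letter in the middle and differ only in the order
  of the outer two. Leaving that order open merges the two patterns into one condition. The three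
  positions need not be adjacent.\<close>

definition valley :: "'a::linorder list \<Rightarrow> bool" where
  "valley xs \<longleftrightarrow> (\<exists>i j k. i < j \<and> j < k \<and> k < length xs \<and> xs ! j < xs ! i \<and> xs ! j < xs ! k)"

lemma valleyI:
  "i < j \<Longrightarrow> j < k \<Longrightarrow> k < length xs \<Longrightarrow> xs ! j < xs ! i \<Longrightarrow> xs ! j < xs ! k \<Longrightarrow> valley xs"
  unfolding valley_def by blast

lemma all_less_3: "(\<forall>a<length [x, y, z]. P a) \<longleftrightarrow> P 0 \<and> P 1 \<and> P 2"
  by (auto simp: less_Suc_eq numeral_2_eq_2)

text \<open>Trades the embedding function for three explicit indices. Of the nine pairs
  \<open>(a, b)\<close>, the three diagonal ones hold trivially; the other six give the listed
  equivalences.\<close>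

lemma contains_pattern_3:
  "contains_pattern \<pi> [x, y, z] \<longleftrightarrow>
     (\<exists>i j k. i < j \<and> j < k \<and> k < length \<pi> \<and>
        (\<pi> ! i < \<pi> ! j \<longleftrightarrow> x < y) \<and> (\<pi> ! j < \<pi> ! i \<longleftrightarrow> y < x) \<and>
        (\<pi> ! i < \<pi> ! k \<longleftrightarrow> x < z) \<and> (\<pi> ! k < \<pi> ! i \<longleftrightarrow> z < x) \<and>
        (\<pi> ! j < \<pi> ! k \<longleftrightarrow> y < z) \<and> (\<pi> ! k < \<pi> ! j \<longleftrightarrow> z < y))"
    (is "_ \<longleftrightarrow> (\<exists>i j k. ?Q i j k)")
proof
  assume "contains_pattern \<pi> [x, y, z]"
  then obtain f where f: "strict_mono_on {..<length [x, y, z]} f"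
      "\<forall>a<length [x, y, z]. f a < length \<pi>"
      "\<forall>a<length [x, y, z]. \<forall>b<length [x, y, z].
         \<pi> ! f a < \<pi> ! f b \<longleftrightarrow> [x, y, z] ! a < [x, y, z] ! b"
    unfolding contains_pattern_def by blast
  have "f 0 < f 1" "f 1 < f 2"
    using f(1) by (auto simp: strict_mono_on_def)
  then have "?Q (f 0) (f 1) (f 2)"
    using f(2,3) unfolding all_less_3 by simp
  then show "\<exists>i j k. ?Q i j k" by blast
next
  assume "\<exists>i j k. ?Q i j k"
  then obtain i j k where Q: "?Q i j k" by blast
  let ?f = "\<lambda>a. [i, j, k] ! a"
  have "strict_mono_on {..<length [x, y, z]} ?f"
    using Q by (auto simp: strict_mono_on_def less_Suc_eq numeral_2_eq_2)
  moreover have "\<forall>a<length [x, y, z]. ?f a < length \<pi>"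
    unfolding all_less_3 using Q by simp
  moreover have "\<forall>a<length [x, y, z]. \<forall>b<length [x, y, z].
      \<pi> ! ?f a < \<pi> ! ?f b \<longleftrightarrow> [x, y, z] ! a < [x, y, z] ! b"
    unfolding all_less_3 using Q by simp
  ultimately show "contains_pattern \<pi> [x, y, z]"
    unfolding contains_pattern_def by blast
qed

text \<open>The outer entries of a valley are distinct; which of them is smaller decides between 213
  and 312.\<close>

lemma avoids_213_312_iff:
  assumes "distinct \<pi>"
  shows "(\<forall>\<rho>\<in>{[2, 1, 3], [3, 1, 2]}. avoids_pattern \<pi> \<rho>) \<longleftrightarrow> \<not> valley \<pi>"
proof
  assume av: "\<forall>\<rho>\<in>{[2, 1, 3], [3, 1, 2]}. avoids_pattern \<pi> \<rho>"
  show "\<not> valley \<pi>"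
  proof
    assume "valley \<pi>"
    then obtain i j k where ijk: "i < j" "j < k" "k < length \<pi>" "\<pi> ! j < \<pi> ! i" "\<pi> ! j < \<pi> ! k"
      unfolding valley_def by blast
    have "\<pi> ! i \<noteq> \<pi> ! k"
      using assms ijk by (simp add: nth_eq_iff_index_eq)
    then consider "\<pi> ! i < \<pi> ! k" | "\<pi> ! k < \<pi> ! i" by linarith
    then have "contains_pattern \<pi> [2, 1, 3] \<or> contains_pattern \<pi> [3, 1, 2]"
    proof cases
      case 1
      then have "contains_pattern \<pi> [2, 1, 3]"
        unfolding contains_pattern_3 using ijk by (intro exI[of _ i] exI[of _ j] exI[of _ k]) auto
      then show ?thesis ..
    next
      case 2
      then have "contains_pattern \<pi> [3, 1, 2]"
        unfolding contains_pattern_3 using ijk by (intro exI[of _ i] exI[of _ j] exI[of _ k]) auto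
      then show ?thesis ..
    qed
    then show False using av by (simp add: avoids_pattern_def)
  qed
next
  assume "\<not> valley \<pi>"
  then show "\<forall>\<rho>\<in>{[2, 1, 3], [3, 1, 2]}. avoids_pattern \<pi> \<rho>"
    by (auto simp: avoids_pattern_def contains_pattern_3 intro: valleyI)
qed

subsection \<open>Unimodal lists\<close>

lemma nth_less_before_peak:
  assumes "sorted_wrt (<) (xs @ [m])" "i < j" "j \<le> length xs"
  shows "(xs @ m # ys) ! i < (xs @ m # ys) ! j"
proof -
  \<comment> \<open>Up to and including the peak at position \<open>length xs\<close>, the whole
    list agrees with \<open>xs @ [m]\<close>.\<close>
  have "(xs @ m # ys) ! l = (xs @ [m]) ! l" if "l \<le> length xs" for l
    using that by (auto simp: nth_append)
  then show ?thesis
    using assms sorted_wrt_nth_less[OF assms(1), of i j] by simp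
qed

lemma nth_greater_after_peak:
  assumes "sorted_wrt (>) (m # ys)" "length xs \<le> i" "i < j" "j < length (xs @ m # ys)"
  shows "(xs @ m # ys) ! j < (xs @ m # ys) ! i"
  using assms sorted_wrt_nth_less[OF assms(1), of "i - length xs" "j - length xs"]
  by (simp add: nth_append)

context
  fixes xs ys :: "nat list" and m :: nat
  assumes incr: "sorted_wrt (<) (xs @ [m])" and decr: "sorted_wrt (>) (m # ys)"
begin

text \<open>If the middle position is at or before the peak, its left neighbour in the valley is
  smaller; if it is after the peak, its right neighbour is.\<close>

lemma unimodal_not_valley: "\<not> valley (xs @ m # ys)"
proof
  assume "valley (xs @ m # ys)"
  then obtain i j k where ijk: "i < j" "j < k" "k < length (xs @ m # ys)"
      "(xs @ m # ys) ! j < (xs @ m # ys) ! i" "(xs @ m # ys) ! j < (xs @ m # ys) ! k"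
    unfolding valley_def by blast
  show False
  proof (cases "j \<le> length xs")
    case True
    with nth_less_before_peak[OF incr ijk(1)] ijk(4) show False
      by (metis less_asym)
  next
    case False
    with nth_greater_after_peak[OF decr _ ijk(2,3)] ijk(5) show False
      by (metis less_asym nat_le_linear)
  qed
qed

lemma asc_unimodal: "asc (xs @ m # ys) = length xs"
proof -
  let ?p = "xs @ m # ys"
  have "?p ! i < ?p ! Suc i \<longleftrightarrow> i < length xs" if "Suc i < length ?p" for i
    using nth_less_before_peak[OF incr, of i "Suc i" ys] nth_greater_after_peak[OF decr, of xs i "Suc i"] that
    by (cases "i < length xs") auto
  \<comment> \<open>Positions start at 0, so the ascents sit exactly at the positions before the
    peak.\<close>
  then have "{i. Suc i < length ?p \<and> ?p ! i < ?p ! Suc i} = {..<length xs}"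
    by auto
  then show ?thesis by (simp add: asc_def)
qed

lemma des_unimodal: "des (xs @ m # ys) = length ys"
proof -
  let ?p = "xs @ m # ys"
  have "?p ! i > ?p ! Suc i \<longleftrightarrow> length xs \<le> i" if "Suc i < length ?p" for i
    using nth_less_before_peak[OF incr, of i "Suc i" ys] nth_greater_after_peak[OF decr, of xs i "Suc i"] that
    by (cases "i < length xs") auto
  \<comment> \<open>The first descent starts at the peak itself. The list has length
    \<open>length xs + length ys + 1\<close>, so the last one starts at
    \<open>length xs + length ys - 1\<close>.\<close>
  then have "{i. Suc i < length ?p \<and> ?p ! i > ?p ! Suc i} = {length xs..<length xs + length ys}"
    by auto
  then show ?thesis by (simp add: des_def)
qed

end

text \<open>A decreasing pair in \<open>xs\<close> forms a valley with \<open>m\<close> on its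
  right, and an increasing pair in \<open>ys\<close> forms one with \<open>m\<close> on its
  left.\<close>

lemma not_valley_imp_unimodal:
  assumes dist: "distinct (xs @ m # ys)" and max: "\<forall>x\<in>set xs \<union> set ys. x < m"
    and nv: "\<not> valley (xs @ m # ys)"
  shows "sorted_wrt (<) xs" "sorted_wrt (>) ys"
proof -
  let ?p = "xs @ m # ys"
  show "sorted_wrt (<) xs"
    unfolding sorted_wrt_iff_nth_less
  proof (intro allI impI, rule ccontr)
    fix i j assume ij: "i < j" "j < length xs" "\<not> xs ! i < xs ! j"
    then have "xs ! j < xs ! i"
      using dist nth_eq_iff_index_eq[of xs i j] by auto
    then have "valley ?p"
      using ij max by (intro valleyI[of i j "length xs"]) (auto simp: nth_append)
    with nv show False ..
  qed
  show "sorted_wrt (>) ys"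
    unfolding sorted_wrt_iff_nth_less
  proof (intro allI impI, rule ccontr)
    fix i j assume ij: "i < j" "j < length ys" "\<not> ys ! j < ys ! i"
    moreover have "distinct ys" using dist by simp
    ultimately have "ys ! i < ys ! j"
      using nth_eq_iff_index_eq[of ys i j] by auto
    then have "valley ?p"
      using ij max
      \<comment> \<open>The peak occupies position \<open>length xs\<close>, so entries of
        \<open>ys\<close> are shifted by one more.\<close>
      by (intro valleyI[of "length xs" "Suc (length xs + i)" "Suc (length xs + j)"])
         (auto simp: nth_append)
    with nv show False ..
  qed
qed

section \<open>Bijection with the subsets of \<open>{1..<n}\<close>\<close>

definition unimodal_perm :: "nat \<Rightarrow> nat set \<Rightarrow> nat list" where
  "unimodal_perm n A = sorted_list_of_set A @ n # rev (sorted_list_of_set ({1..<n} - A))"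

context
  fixes n :: nat and A :: "nat set"
  assumes A: "A \<subseteq> {1..<n}"
begin

lemma finite_left_part: "finite A"
  using A finite_subset by blast

lemma unimodal_perm_incr: "sorted_wrt (<) (sorted_list_of_set A @ [n])"
  using A finite_left_part by (auto simp: sorted_wrt_append)

lemma unimodal_perm_decr: "sorted_wrt (>) (n # rev (sorted_list_of_set ({1..<n} - A)))"
  by (auto simp: sorted_wrt_rev)

lemma unimodal_perm_in_permutations:
  assumes "n \<ge> 1"
  shows "unimodal_perm n A \<in> permutations_of_set {1..n}"
  using A assms finite_left_part
  by (intro permutations_of_setI) (auto simp: unimodal_perm_def)

lemma not_valley_unimodal_perm: "\<not> valley (unimodal_perm n A)"
  unfolding unimodal_perm_def
  by (rule unimodal_not_valley[OF unimodal_perm_incr unimodal_perm_decr])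

lemma asc_unimodal_perm: "asc (unimodal_perm n A) = card A"
  unfolding unimodal_perm_def
  by (subst asc_unimodal[OF unimodal_perm_incr unimodal_perm_decr]) simp

lemma des_unimodal_perm: "des (unimodal_perm n A) = n - 1 - card A"
  unfolding unimodal_perm_def
  by (subst des_unimodal[OF unimodal_perm_incr unimodal_perm_decr])
     (use A finite_left_part in \<open>simp add: card_Diff_subset\<close>)

end

lemma unimodal_perm_surj:
  assumes "n \<ge> 1" and p: "\<pi> \<in> permutations_of_set {1..n}" and nv: "\<not> valley \<pi>"
  obtains A where "A \<subseteq> {1..<n}" "\<pi> = unimodal_perm n A"
proof -
  have set: "set \<pi> = {1..n}" and dist: "distinct \<pi>"
    using p by (auto dest: permutations_of_setD)
  then have "n \<in> set \<pi>" using assms(1) by simp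
  then obtain xs ys where pi: "\<pi> = xs @ n # ys" by (meson split_list)
  have un: "set xs \<union> set ys = {1..n} - {n}" and ys: "set ys = ({1..n} - {n}) - set xs"
    using set dist unfolding pi by auto
  have "\<forall>x\<in>set xs \<union> set ys. x < n"
    unfolding un by auto
  note sorted = not_valley_imp_unimodal[OF dist[unfolded pi] this nv[unfolded pi]]
  have "{1..n} - {n} = {1..<n}" by auto
  then have sub: "set xs \<subseteq> {1..<n}" and ys': "set ys = {1..<n} - set xs"
    using un ys by auto
  \<comment> \<open>A strictly increasing list is recovered from its set of entries. This applies to
    \<open>xs\<close> directly and to the decreasing \<open>ys\<close> after reversal.\<close>
  have "sorted_list_of_set (set xs) = xs"
    using sorted(1) by (simp add: sorted_list_of_set.idem_if_sorted_distinct strict_sorted_iff)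
  moreover have "sorted_wrt (<) (rev ys)"
    using sorted(2) by (simp add: sorted_wrt_rev)
  then have "sorted_list_of_set (set ys) = rev ys"
    using sorted_list_of_set.idem_if_sorted_distinct[of "rev ys"] by (simp add: strict_sorted_iff)
  ultimately have "\<pi> = unimodal_perm n (set xs)"
    unfolding unimodal_perm_def pi ys'[symmetric] by simp
  with sub that show thesis by blast
qed

text \<open>Since \<open>n\<close> occurs only once, equal lists split at the same place, and the
  entries before \<open>n\<close> give back the subset.\<close>

lemma inj_on_unimodal_perm: "inj_on (unimodal_perm n) (Pow {1..<n})"
proof (rule inj_onI)
  fix A B assume AB: "A \<in> Pow {1..<n}" "B \<in> Pow {1..<n}" "unimodal_perm n A = unimodal_perm n B"
  then have fin: "finite A" "finite B" by (auto intro: finite_subset)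
  have "n \<notin> set (sorted_list_of_set A)" "n \<notin> set (sorted_list_of_set B)"
    using AB fin by auto
  moreover have "n \<notin> set (rev (sorted_list_of_set ({1..<n} - A)))"
    by simp
  ultimately have "sorted_list_of_set A = sorted_list_of_set B"
    using AB(3) unfolding unimodal_perm_def by (simp add: append_Cons_eq_iff)
  then show "A = B"
    using fin by (metis sorted_list_of_set.set_sorted_key_list_of_set)
qed

section \<open>Counting by ascents and descents\<close>

text \<open>Treats ascents and descents at once: \<open>f\<close> is the statistic, and on
  \<open>unimodal_perm n A\<close> it depends on \<open>A\<close> only through its size, by way of
  \<open>g\<close>.\<close>

lemma card_avoiders_with:
  assumes "n \<ge> 1"
    and f: "\<And>A. A \<subseteq> {1..<n} \<Longrightarrow> f (unimodal_perm n A) = g (card A)"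
  shows "card {\<pi> \<in> permutations_of_set {1..n}.
           (\<forall>\<rho>\<in>{[2, 1, 3], [3, 1, 2]}. avoids_pattern \<pi> \<rho>) \<and> f \<pi> = k} =
         card {A. A \<subseteq> {1..<n} \<and> g (card A) = k}"
proof -
  have "{\<pi> \<in> permutations_of_set {1..n}.
           (\<forall>\<rho>\<in>{[2, 1, 3], [3, 1, 2]}. avoids_pattern \<pi> \<rho>) \<and> f \<pi> = k} =
        {\<pi> \<in> permutations_of_set {1..n}. \<not> valley \<pi> \<and> f \<pi> = k}"
    using avoids_213_312_iff permutations_of_setD(2) by blast
  also have "\<dots> = unimodal_perm n ` {A. A \<subseteq> {1..<n} \<and> g (card A) = k}"
  proof (intro equalityI subsetI)
    fix \<pi> assume \<pi>: "\<pi> \<in> {\<pi> \<in> permutations_of_set {1..n}. \<not> valley \<pi> \<and> f \<pi> = k}"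
    then obtain A where A: "A \<subseteq> {1..<n}" "\<pi> = unimodal_perm n A"
      using unimodal_perm_surj[OF assms(1), of \<pi>] by auto
    then have "g (card A) = k" using \<pi> f[of A] by simp
    with A show "\<pi> \<in> unimodal_perm n ` {A. A \<subseteq> {1..<n} \<and> g (card A) = k}"
      by simp
  next
    fix \<pi> assume "\<pi> \<in> unimodal_perm n ` {A. A \<subseteq> {1..<n} \<and> g (card A) = k}"
    then obtain A where A: "A \<subseteq> {1..<n}" "\<pi> = unimodal_perm n A" "g (card A) = k"
      by auto
    then show "\<pi> \<in> {\<pi> \<in> permutations_of_set {1..n}. \<not> valley \<pi> \<and> f \<pi> = k}"
      using f[OF A(1)] unimodal_perm_in_permutations[OF A(1) assms(1)]
        not_valley_unimodal_perm[OF A(1)] by simp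
  qed
  moreover have "inj_on (unimodal_perm n) {A. A \<subseteq> {1..<n} \<and> g (card A) = k}"
    by (rule inj_on_subset[OF inj_on_unimodal_perm]) auto
  ultimately show ?thesis
    by (simp only: card_image)
qed

theorem proposition6:
  fixes n k :: nat
  assumes "n \<ge> 1"
  shows "a_asc n k {[2, 1, 3], [3, 1, 2]} = a_des n k {[2, 1, 3], [3, 1, 2]} \<and>
         a_des n k {[2, 1, 3], [3, 1, 2]} = (n - 1) choose k"
proof -
  have "a_asc n k {[2, 1, 3], [3, 1, 2]} = card {A. A \<subseteq> {1..<n} \<and> card A = k}"
    unfolding a_asc_def
    by (rule card_avoiders_with[OF assms, where g = "\<lambda>c. c"]) (rule asc_unimodal_perm)
  then have asc: "a_asc n k {[2, 1, 3], [3, 1, 2]} = (n - 1) choose k"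
    by (simp add: n_subsets)
  \<comment> \<open>This bound makes the natural-number subtraction \<open>n - 1 - card A\<close>
    exact, so that it can be solved for \<open>card A\<close>.\<close>
  have card_le: "card A \<le> n - 1" if "A \<subseteq> {1..<n}" for A
    using card_mono[OF _ that] by simp
  have "a_des n k {[2, 1, 3], [3, 1, 2]} = card {A. A \<subseteq> {1..<n} \<and> n - 1 - card A = k}"
    unfolding a_des_def
    by (rule card_avoiders_with[OF assms, where g = "\<lambda>c. n - 1 - c"]) (rule des_unimodal_perm)
  also have "\<dots> = (n - 1) choose k"
  proof (cases "k \<le> n - 1")
    case True
    have "{A. A \<subseteq> {1..<n} \<and> n - 1 - card A = k} = {A. A \<subseteq> {1..<n} \<and> card A = n - 1 - k}"
    proof (intro Collect_cong conj_cong refl)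
      fix A :: "nat set" assume "A \<subseteq> {1..<n}"
      then show "n - 1 - card A = k \<longleftrightarrow> card A = n - 1 - k"
        using card_le[of A] True by linarith
    qed
    then show ?thesis
      \<comment> \<open>Subsets of size \<open>n - 1 - k\<close> are as many as those of size
        \<open>k\<close>, by symmetry of the binomial coefficients.\<close>
      using True by (simp add: n_subsets binomial_symmetric[of k])
  next
    case False
    \<comment> \<open>The difference \<open>n - 1 - card A\<close> never exceeds
      \<open>n - 1\<close>, hence cannot reach \<open>k\<close>.\<close>
    then have "{A. A \<subseteq> {1..<n} \<and> n - 1 - card A = k} = {}" by auto
    with False show ?thesis by (simp add: binomial_eq_0)
  qed
  finally show ?thesis using asc by simp
qed

end
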